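(* Let $M$ be a monoid, $I$ a non-empty set, and let $S=\mathcal{B}(M;I)^1$ be the Brandt monoid over $M$. If $S$ is right coherent, then so is $M$.
   Context: For a monoid $M$ and non-empty set $I$, the Brandt semigroup $\mathcal{B}(M;I)$ is the set $(I\times M\times I)\cup\{0\}$, where $0$ is a new symbol, with multiplication \[(i,a,j)(k,b,\ell)=\begin{cases}(i,ab,\ell)&\text{if }j=k,\\ 0&\text{if }j\neq k,\end{cases}\qquad 0(i,a,j)=(i,a,j)0=0\cdot0=0.\] The Brandt monoid $\mathcal{B}(M;I)^1$ is obtained from it by adjoining a new identity element $1$. Let $S$ be a monoid. A right $S$-act is a set $A$ with a map $A\times S\to A$, $(a,s)\mapsto as$, with $a1=a$ and $a(st)=(as)t$. The free right $S$-act on a set $X$ is $F_S(X)=X\times S$ with $(x,s)t=(x,st)$. A congruence on a right $S$-act is an equivalence relation preserved by the action; it is finitely generated if it is the smallest congruence containing some finite set of pairs. An act $A$ is finitely generated if $A=a_1S\cup\dots\cup a_nS$ for some $a_i\in A$, and finitely presented if it is isomorphic to $F_S(X)/\rho$ with $X$ finite and $\rho$ a finitely generated congruence. The empty set is allowed as a subact (and is finitely generated). The monoid $S$ is right coherent if every finitely generated subact of every finitely presented right $S$-act is finitely presented. *)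

theory Defs
  imports "HOL-Algebra.Group"
begin

section \<open>Brandt semigroups and Brandt monoids\<close>

datatype ('i, 'a) brandt = Zero | Triple 'i 'a 'i

definition brandt_carrier :: "('a, 'b) monoid_scheme \<Rightarrow> 'i set \<Rightarrow> ('i, 'a) brandt set" where
  "brandt_carrier M I =
     insert Zero {Triple i a j | i a j. i \<in> I \<and> a \<in> carrier M \<and> j \<in> I}"

fun brandt_mult ::
  "('a, 'b) monoid_scheme \<Rightarrow> ('i, 'a) brandt \<Rightarrow> ('i, 'a) brandt \<Rightarrow> ('i, 'a) brandt" where
  "brandt_mult M (Triple i a j) (Triple k b l) =
     (if j = k then Triple i (a \<otimes>\<^bsub>M\<^esub> b) l else Zero)"
| "brandt_mult M Zero y = Zero"
| "brandt_mult M x Zero = Zero"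

text \<open>The new identity is \<^term>\<open>None\<close>; it is adjoined even if an identity already exists.\<close>

fun adjoin_one_mult :: "('s \<Rightarrow> 's \<Rightarrow> 's) \<Rightarrow> 's option \<Rightarrow> 's option \<Rightarrow> 's option" where
  "adjoin_one_mult m None y = y"
| "adjoin_one_mult m x None = x"
| "adjoin_one_mult m (Some x) (Some y) = Some (m x y)"

definition adjoin_one :: "'s set \<Rightarrow> ('s \<Rightarrow> 's \<Rightarrow> 's) \<Rightarrow> 's option monoid" where
  "adjoin_one C m =
     \<lparr>carrier = insert None (Some ` C), mult = adjoin_one_mult m, one = None\<rparr>"

definition brandt_monoid ::
  "('a, 'b) monoid_scheme \<Rightarrow> 'i set \<Rightarrow> ('i, 'a) brandt option monoid" where
  "brandt_monoid M I = adjoin_one (brandt_carrier M I) (brandt_mult M)"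

lemma monoid_adjoin_one:
  assumes closed: "\<And>x y. x \<in> C \<Longrightarrow> y \<in> C \<Longrightarrow> m x y \<in> C"
    and assoc: "\<And>x y z. x \<in> C \<Longrightarrow> y \<in> C \<Longrightarrow> z \<in> C \<Longrightarrow> m (m x y) z = m x (m y z)"
  shows "monoid (adjoin_one C m)"
proof (rule monoidI)
  fix x y z
  assume "x \<in> carrier (adjoin_one C m)" "y \<in> carrier (adjoin_one C m)"
  then show "x \<otimes>\<^bsub>adjoin_one C m\<^esub> y \<in> carrier (adjoin_one C m)"
    by (cases x; cases y) (auto simp: adjoin_one_def closed)
next
  fix x y z
  assume "x \<in> carrier (adjoin_one C m)" "y \<in> carrier (adjoin_one C m)"
    "z \<in> carrier (adjoin_one C m)"
  then show "x \<otimes>\<^bsub>adjoin_one C m\<^esub> y \<otimes>\<^bsub>adjoin_one C m\<^esub> z =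
      x \<otimes>\<^bsub>adjoin_one C m\<^esub> (y \<otimes>\<^bsub>adjoin_one C m\<^esub> z)"
    by (cases x; cases y; cases z) (auto simp: adjoin_one_def assoc)
next
  fix x
  assume "x \<in> carrier (adjoin_one C m)"
  then show "x \<otimes>\<^bsub>adjoin_one C m\<^esub> \<one>\<^bsub>adjoin_one C m\<^esub> = x"
    by (cases x) (auto simp: adjoin_one_def)
qed (auto simp: adjoin_one_def)

lemma monoid_brandt_monoid:
  assumes "monoid M"
  shows "monoid (brandt_monoid M I)"
proof -
  interpret monoid M by fact
  show ?thesis
    unfolding brandt_monoid_def
  proof (rule monoid_adjoin_one)
    fix x y
    assume "x \<in> brandt_carrier M I" "y \<in> brandt_carrier M I"
    then show "brandt_mult M x y \<in> brandt_carrier M I"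
      by (cases x; cases y) (simp_all add: brandt_carrier_def)
  next
    fix x y z
    assume "x \<in> brandt_carrier M I" "y \<in> brandt_carrier M I" "z \<in> brandt_carrier M I"
    then show "brandt_mult M (brandt_mult M x y) z = brandt_mult M x (brandt_mult M y z)"
      by (cases x; cases y; cases z) (simp_all add: brandt_carrier_def m_assoc)
  qed
qed

section \<open>Right acts over a monoid\<close>

locale right_act = monoid S for S (structure) +
  fixes A :: "'x set" and act :: "'x \<Rightarrow> 'a \<Rightarrow> 'x"
  assumes act_closed: "\<lbrakk>x \<in> A; s \<in> carrier S\<rbrakk> \<Longrightarrow> act x s \<in> A"
    and act_one: "x \<in> A \<Longrightarrow> act x \<one> = x"
    and act_mult:
      "\<lbrakk>x \<in> A; s \<in> carrier S; t \<in> carrier S\<rbrakk> \<Longrightarrow> act x (s \<otimes> t) = act (act x s) t"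

definition subact ::
  "('a, 'b) monoid_scheme \<Rightarrow> 'x set \<Rightarrow> 'x set \<Rightarrow> ('x \<Rightarrow> 'a \<Rightarrow> 'x) \<Rightarrow> bool" where
  "subact S B A act \<longleftrightarrow> B \<subseteq> A \<and> (\<forall>x\<in>B. \<forall>s\<in>carrier S. act x s \<in> B)"

definition finitely_generated_act ::
  "('a, 'b) monoid_scheme \<Rightarrow> 'x set \<Rightarrow> ('x \<Rightarrow> 'a \<Rightarrow> 'x) \<Rightarrow> bool" where
  "finitely_generated_act S A act \<longleftrightarrow>
     (\<exists>G. finite G \<and> G \<subseteq> A \<and> A = (\<Union>a\<in>G. act a ` carrier S))"

definition act_iso ::
  "('a, 'b) monoid_scheme \<Rightarrow> 'x set \<Rightarrow> ('x \<Rightarrow> 'a \<Rightarrow> 'x) \<Rightarrow> 'y set \<Rightarrow> ('y \<Rightarrow> 'a \<Rightarrow> 'y) \<Rightarrow>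
     ('x \<Rightarrow> 'y) \<Rightarrow> bool" where
  "act_iso S A actA B actB f \<longleftrightarrow>
     bij_betw f A B \<and> (\<forall>x\<in>A. \<forall>s\<in>carrier S. f (actA x s) = actB (f x) s)"

definition free_act_carrier :: "('a, 'b) monoid_scheme \<Rightarrow> 'x set \<Rightarrow> ('x \<times> 'a) set" where
  "free_act_carrier S X = X \<times> carrier S"

definition free_act :: "('a, 'b) monoid_scheme \<Rightarrow> 'x \<times> 'a \<Rightarrow> 'a \<Rightarrow> 'x \<times> 'a" where
  "free_act S p t = (fst p, snd p \<otimes>\<^bsub>S\<^esub> t)"

definition act_congruence ::
  "('a, 'b) monoid_scheme \<Rightarrow> 'x set \<Rightarrow> ('x \<Rightarrow> 'a \<Rightarrow> 'x) \<Rightarrow> ('x \<times> 'x) set \<Rightarrow> bool" where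
  "act_congruence S A act \<rho> \<longleftrightarrow>
     equiv A \<rho> \<and> (\<forall>(x, y)\<in>\<rho>. \<forall>s\<in>carrier S. (act x s, act y s) \<in> \<rho>)"

definition finitely_generated_congruence ::
  "('a, 'b) monoid_scheme \<Rightarrow> 'x set \<Rightarrow> ('x \<Rightarrow> 'a \<Rightarrow> 'x) \<Rightarrow> ('x \<times> 'x) set \<Rightarrow> bool" where
  "finitely_generated_congruence S A act \<rho> \<longleftrightarrow>
     act_congruence S A act \<rho> \<and>
     (\<exists>Z. finite Z \<and> Z \<subseteq> \<rho> \<and> (\<forall>\<sigma>. act_congruence S A act \<sigma> \<and> Z \<subseteq> \<sigma> \<longrightarrow> \<rho> \<subseteq> \<sigma>))"

text \<open>
  The action on the quotient \<^term>\<open>A // \<rho>\<close>: for a congruence \<^term>\<open>\<rho>\<close> all sets in the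
  union coincide.
\<close>

definition quotient_act ::
  "('x \<Rightarrow> 'a \<Rightarrow> 'x) \<Rightarrow> ('x \<times> 'x) set \<Rightarrow> 'x set \<Rightarrow> 'a \<Rightarrow> 'x set" where
  "quotient_act act \<rho> C s = (\<Union>x\<in>C. \<rho> `` {act x s})"

text \<open>
  A definition cannot quantify over types, so the finite basis is taken to be a set of natural
  numbers; \<open>finitely_presentedI\<close> below shows that a basis of any type may be used.
\<close>

definition finitely_presented ::
  "('a, 'b) monoid_scheme \<Rightarrow> 'x set \<Rightarrow> ('x \<Rightarrow> 'a \<Rightarrow> 'x) \<Rightarrow> bool" where
  "finitely_presented S A act \<longleftrightarrow>
     right_act S A act \<and>
     (\<exists>(X :: nat set) \<rho> f.
        finite X \<and>
        finitely_generated_congruence S (free_act_carrier S X) (free_act S) \<rho> \<and>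
        act_iso S A act (free_act_carrier S X // \<rho>) (quotient_act (free_act S) \<rho>) f)"

text \<open>
  For the same reason the carriers below are of the type of the quotients \<open>F\<^sub>S(X)/\<rho>\<close> with
  \<open>X\<close> a set of naturals, which contains a copy of every finitely presented act;
  \<open>right_coherentD\<close> below shows that the property then holds for acts over any type.
\<close>

definition right_coherent :: "('a, 'b) monoid_scheme \<Rightarrow> bool" where
  "right_coherent S \<longleftrightarrow>
     (\<forall>(A :: (nat \<times> 'a) set set) act B.
        finitely_presented S A act \<and> subact S B A act \<and> finitely_generated_act S B act
        \<longrightarrow> finitely_presented S B act)"

section \<open>Independence of the chosen types\<close>

lemma act_iso_comp:
  assumes "act_iso S A a B b f" "act_iso S B b C c g"
  shows "act_iso S A a C c (g \<circ> f)"
proof -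
  have "bij_betw (g \<circ> f) A C"
    using assms by (auto simp: act_iso_def intro: bij_betw_trans)
  moreover have "f x \<in> B" if "x \<in> A" for x
    using assms(1) that by (auto simp: act_iso_def bij_betw_def)
  ultimately show ?thesis
    using assms by (auto simp: act_iso_def)
qed

lemma act_iso_inv:
  assumes f: "act_iso S A a B b f"
    and cl: "\<And>x s. x \<in> A \<Longrightarrow> s \<in> carrier S \<Longrightarrow> a x s \<in> A"
  shows "act_iso S B b A a (inv_into A f)"
proof -
  have bij: "bij_betw f A B" using f by (simp add: act_iso_def)
  have "inv_into A f (b y s) = a (inv_into A f y) s" if y: "y \<in> B" "s \<in> carrier S" for y s
  proof -
    from y bij obtain x where x: "x \<in> A" "y = f x" by (auto simp: bij_betw_def)
    then have "b y s = f (a x s)" using f y by (auto simp: act_iso_def)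
    then show ?thesis using x cl[OF x(1) y(2)] bij by (simp add: bij_betw_def)
  qed
  then show ?thesis using bij by (simp add: act_iso_def bij_betw_inv_into)
qed

lemma act_iso_sub:
  assumes "act_iso S A a B b f" "C \<subseteq> A"
  shows "act_iso S C a (f ` C) b f"
  using assms by (auto simp: act_iso_def bij_betw_def intro: inj_on_subset)

lemma right_act_iso:
  assumes A: "right_act S A a" and f: "act_iso S A a B b f"
  shows "right_act S B b"
proof -
  interpret right_act S A a by fact
  have im: "B = f ` A" and eq: "\<And>x s. x \<in> A \<Longrightarrow> s \<in> carrier S \<Longrightarrow> b (f x) s = f (a x s)"
    using f by (auto simp: act_iso_def bij_betw_def)
  show ?thesis
    by unfold_locales (auto simp: im eq act_closed act_one act_mult)
qed

lemma right_act_subact: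
  assumes "right_act S A a" "subact S B A a"
  shows "right_act S B a"
proof -
  interpret right_act S A a by fact
  show ?thesis
    using assms(2) by unfold_locales (auto simp: subact_def act_one act_mult subset_iff)
qed

lemma act_congruence_image:
  assumes f: "act_iso S A a B b f" and r: "act_congruence S A a \<rho>"
  shows "act_congruence S B b (map_prod f f ` \<rho>)"
proof -
  have inj: "inj_on f A" and im: "B = f ` A"
    and eq: "\<And>x s. x \<in> A \<Longrightarrow> s \<in> carrier S \<Longrightarrow> b (f x) s = f (a x s)"
    using f by (auto simp: act_iso_def bij_betw_def)
  have sub: "\<rho> \<subseteq> A \<times> A" and rf: "refl_on A \<rho>" and sy: "sym \<rho>" and tr: "trans \<rho>"
    and cg: "\<And>x y s. (x, y) \<in> \<rho> \<Longrightarrow> s \<in> carrier S \<Longrightarrow> (a x s, a y s) \<in> \<rho>"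
    using r by (auto simp: act_congruence_def equiv_def)
  have "equiv B (map_prod f f ` \<rho>)"
  proof (rule equivI)
    show "map_prod f f ` \<rho> \<subseteq> B \<times> B" using sub im by auto
    show "refl_on B (map_prod f f ` \<rho>)"
      using rf im by (auto simp: refl_on_def)
    show "sym (map_prod f f ` \<rho>)" using sy by (force simp: sym_def)
    show "trans (map_prod f f ` \<rho>)"
    proof (rule transI)
      fix x y z assume "(x, y) \<in> map_prod f f ` \<rho>" "(y, z) \<in> map_prod f f ` \<rho>"
      then obtain u v v' w where "(u, v) \<in> \<rho>" "x = f u" "y = f v"
        "(v', w) \<in> \<rho>" "y = f v'" "z = f w" by auto
      moreover from this have "v = v'" using sub inj by (auto dest: inj_onD)
      ultimately show "(x, z) \<in> map_prod f f ` \<rho>" using tr by (auto dest: transD)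
    qed
  qed
  moreover have "(b x s, b y s) \<in> map_prod f f ` \<rho>"
    if xy: "(x, y) \<in> map_prod f f ` \<rho>" and s: "s \<in> carrier S" for x y s
  proof -
    from xy obtain u v where uv: "(u, v) \<in> \<rho>" "x = f u" "y = f v" by auto
    then have "b x s = f (a u s)" "b y s = f (a v s)" using sub s eq by auto
    then show ?thesis using cg[OF uv(1) s] by auto
  qed
  ultimately show ?thesis unfolding act_congruence_def by blast
qed

lemma finitely_generated_congruence_image:
  assumes f: "act_iso S A a B b f" and r: "finitely_generated_congruence S A a \<rho>"
    and cl: "\<And>x s. x \<in> A \<Longrightarrow> s \<in> carrier S \<Longrightarrow> a x s \<in> A"
  shows "finitely_generated_congruence S B b (map_prod f f ` \<rho>)"
proof -
  let ?g = "inv_into A f"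
  have inj: "inj_on f A" and im: "B = f ` A"
    using f by (auto simp: act_iso_def bij_betw_def)
  obtain Z where cg: "act_congruence S A a \<rho>" and Z: "finite Z" "Z \<subseteq> \<rho>"
    and least: "\<And>\<sigma>. act_congruence S A a \<sigma> \<Longrightarrow> Z \<subseteq> \<sigma> \<Longrightarrow> \<rho> \<subseteq> \<sigma>"
    using r by (auto simp: finitely_generated_congruence_def)
  have sub: "\<rho> \<subseteq> A \<times> A" using cg by (auto simp: act_congruence_def equiv_def)
  have min: "map_prod f f ` \<rho> \<subseteq> \<sigma>"
    if s: "act_congruence S B b \<sigma>" and Zs: "map_prod f f ` Z \<subseteq> \<sigma>" for \<sigma>
  proof -
    have "Z \<subseteq> map_prod ?g ?g ` \<sigma>"
    proof clarify
      fix x y assume xy: "(x, y) \<in> Z"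
      then have "x \<in> A" "y \<in> A" "(f x, f y) \<in> \<sigma>" using Z sub Zs by auto
      then show "(x, y) \<in> map_prod ?g ?g ` \<sigma>"
        using inj by (intro image_eqI[of _ _ "(f x, f y)"]) auto
    qed
    then have le: "\<rho> \<subseteq> map_prod ?g ?g ` \<sigma>"
      using least act_congruence_image[OF act_iso_inv[OF f cl] s] by blast
    have "\<sigma> \<subseteq> B \<times> B" using s by (auto simp: act_congruence_def equiv_def)
    then show ?thesis using le im by (fastforce simp: f_inv_into_f)
  qed
  show ?thesis
    unfolding finitely_generated_congruence_def
  proof (intro conjI exI[of _ "map_prod f f ` Z"] allI impI)
    show "act_congruence S B b (map_prod f f ` \<rho>)"
      by (rule act_congruence_image[OF f cg])
    show "finite (map_prod f f ` Z)" "map_prod f f ` Z \<subseteq> map_prod f f ` \<rho>"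
      using Z by (auto intro: image_mono)
    show "map_prod f f ` \<rho> \<subseteq> \<sigma>"
      if "act_congruence S B b \<sigma> \<and> map_prod f f ` Z \<subseteq> \<sigma>" for \<sigma>
      using min that by simp
  qed
qed

lemma act_iso_quotient:
  assumes f: "act_iso S A a B b f" and r: "act_congruence S A a \<rho>"
    and cl: "\<And>x s. x \<in> A \<Longrightarrow> s \<in> carrier S \<Longrightarrow> a x s \<in> A"
  shows "act_iso S (A // \<rho>) (quotient_act a \<rho>)
    (B // (map_prod f f ` \<rho>)) (quotient_act b (map_prod f f ` \<rho>)) ((`) f)"
proof -
  have inj: "inj_on f A" and im: "B = f ` A"
    and eq: "\<And>x s. x \<in> A \<Longrightarrow> s \<in> carrier S \<Longrightarrow> b (f x) s = f (a x s)"
    using f by (auto simp: act_iso_def bij_betw_def)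
  have sub: "\<rho> \<subseteq> A \<times> A" using r by (auto simp: act_congruence_def equiv_def)
  have cls: "(map_prod f f ` \<rho>) `` {f z} = f ` (\<rho> `` {z})" if "z \<in> A" for z
  proof (rule Set.set_eqI)
    fix w
    have "w \<in> (map_prod f f ` \<rho>) `` {f z} \<longleftrightarrow> (\<exists>u v. (u, v) \<in> \<rho> \<and> f u = f z \<and> w = f v)"
      by force
    also have "\<dots> \<longleftrightarrow> (\<exists>v. (z, v) \<in> \<rho> \<and> w = f v)"
      using that sub inj by (metis SigmaD1 inj_onD subsetD)
    finally show "w \<in> (map_prod f f ` \<rho>) `` {f z} \<longleftrightarrow> w \<in> f ` (\<rho> `` {z})"
      by auto
  qed
  have QA: "C \<subseteq> A" if "C \<in> A // \<rho>" for C
    using that sub by (auto simp: quotient_def)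
  have "inj_on ((`) f) (A // \<rho>)"
    using QA inj by (auto intro!: inj_onI simp: inj_on_image_eq_iff)
  moreover have "(`) f ` (A // \<rho>) = B // (map_prod f f ` \<rho>)"
    by (auto simp: quotient_def im cls)
  moreover have "f ` quotient_act a \<rho> C s = quotient_act b (map_prod f f ` \<rho>) (f ` C) s"
    if "C \<in> A // \<rho>" "s \<in> carrier S" for C s
  proof -
    have "(map_prod f f ` \<rho>) `` {b (f x) s} = f ` (\<rho> `` {a x s})" if "x \<in> C" for x
      using QA \<open>C \<in> _\<close> \<open>s \<in> _\<close> that cl cls eq by (metis subsetD)
    then show ?thesis by (auto simp: quotient_act_def image_UN)
  qed
  ultimately show ?thesis by (auto simp: act_iso_def bij_betw_def)
qed

lemma finitely_presentedI:
  fixes X :: "'y set"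
  assumes A: "right_act S A act" and X: "finite X"
    and r: "finitely_generated_congruence S (free_act_carrier S X) (free_act S) \<rho>"
    and f: "act_iso S A act (free_act_carrier S X // \<rho>) (quotient_act (free_act S) \<rho>) f"
  shows "finitely_presented S A act"
proof -
  interpret right_act S A act by fact
  obtain g :: "'y \<Rightarrow> nat" where g: "inj_on g X"
    using X finite_imp_inj_to_nat_seg by blast
  let ?h = "map_prod g id :: 'y \<times> _ \<Rightarrow> _"
  have h: "act_iso S (free_act_carrier S X) (free_act S)
      (free_act_carrier S (g ` X)) (free_act S) ?h"
    using g map_prod_inj_on[OF g inj_on_id, of "carrier S"]
      map_prod_surj_on[of g X "g ` X" id "carrier S" "carrier S"]
    by (auto simp: act_iso_def bij_betw_def free_act_carrier_def free_act_def)
  have cl: "free_act S p s \<in> free_act_carrier S X"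
    if "p \<in> free_act_carrier S X" "s \<in> carrier S" for p s
    using that by (auto simp: free_act_carrier_def free_act_def)
  have cg: "act_congruence S (free_act_carrier S X) (free_act S) \<rho>"
    using r by (simp add: finitely_generated_congruence_def)
  show ?thesis
    unfolding finitely_presented_def
    using A X finitely_generated_congruence_image[OF h r cl]
      act_iso_comp[OF f act_iso_quotient[OF h cg cl]] by blast
qed

lemma right_coherentD:
  fixes S :: "('a, 'b) monoid_scheme" and A :: "'x set"
  assumes S: "right_coherent S" and A: "finitely_presented S A act"
    and B: "subact S B A act" and G: "finitely_generated_act S B act"
  shows "finitely_presented S B act"
proof -
  obtain X :: "nat set" and \<rho> f where ra: "right_act S A act" and X: "finite X"
    and r: "finitely_generated_congruence S (free_act_carrier S X) (free_act S) \<rho>"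
    and f: "act_iso S A act (free_act_carrier S X // \<rho>) (quotient_act (free_act S) \<rho>) f"
    using A unfolding finitely_presented_def by blast
  let ?Q = "free_act_carrier S X // \<rho>" and ?q = "quotient_act (free_act S) \<rho>"
  have "act_iso S ?Q ?q ?Q ?q id" by (auto simp: act_iso_def)
  then have Q: "finitely_presented S ?Q ?q"
    by (intro finitely_presentedI[OF right_act_iso[OF ra f] X r])
  have im: "?Q = f ` A"
    and eq: "\<And>x s. x \<in> A \<Longrightarrow> s \<in> carrier S \<Longrightarrow> ?q (f x) s = f (act x s)"
    using f by (auto simp: act_iso_def bij_betw_def)
  have BA: "B \<subseteq> A" using B by (simp add: subact_def)
  have sB: "subact S (f ` B) ?Q ?q"
    unfolding subact_def
  proof (intro conjI ballI)
    show "f ` B \<subseteq> ?Q" using BA im by auto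
    fix y s assume "y \<in> f ` B" and s: "s \<in> carrier S"
    then obtain x where x: "x \<in> B" "y = f x" by auto
    then have "?q y s = f (act x s)" using eq BA s by auto
    then show "?q y s \<in> f ` B" using B x s by (auto simp: subact_def)
  qed
  obtain K where K: "finite K" "K \<subseteq> B" "B = (\<Union>x\<in>K. act x ` carrier S)"
    using G by (auto simp: finitely_generated_act_def)
  have "?q (f x) ` carrier S = f ` act x ` carrier S" if "x \<in> K" for x
    using that K(2) BA eq by (auto simp: image_image intro!: image_cong)
  then have "f ` (\<Union>x\<in>K. act x ` carrier S) = (\<Union>y\<in>f ` K. ?q y ` carrier S)"
    by (simp add: image_UN)
  then have "f ` B = (\<Union>y\<in>f ` K. ?q y ` carrier S)" 
    by (simp only: K(3)[symmetric])
  moreover have "finite (f ` K)" "f ` K \<subseteq> f ` B" using K(1,2) by auto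
  ultimately have "finitely_generated_act S (f ` B) ?q"
    unfolding finitely_generated_act_def by blast
  then have "finitely_presented S (f ` B) ?q"
    using S Q sB unfolding right_coherent_def by blast
  then obtain Y :: "nat set" and \<sigma> g where Y: "finite Y"
    "finitely_generated_congruence S (free_act_carrier S Y) (free_act S) \<sigma>"
    "act_iso S (f ` B) ?q (free_act_carrier S Y // \<sigma>) (quotient_act (free_act S) \<sigma>) g"
    unfolding finitely_presented_def by blast
  then show ?thesis
    by (intro finitely_presentedI[OF right_act_subact[OF ra B] Y(1,2)
          act_iso_comp[OF act_iso_sub[OF f BA] Y(3)]])
qed

end

theory Submission
  imports Defs
begin

text \<open>
  An \<open>M\<close>-act \<open>A\<close> is extended to the \<open>S\<close>-act \<open>A' = (A \<times> I) \<union> {0}\<close> with \<open>(x, j)(j, a, l) = (xa, l)\<close>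
  and all other products with non-identity elements equal to \<open>0\<close>; the \<open>M\<close>-act \<open>A\<close> is then found
  inside \<open>A'\<close> as \<open>A \<times> {i}\<close> for any \<open>i \<in> I\<close>. If \<open>A\<close> is finitely presented, so is \<open>A'\<close>: besides the
  relations of \<open>A\<close>, one only needs \<open>x = x(i, 1, i)\<close> for the generators and the identification of all
  zeros. Hence for a finitely generated subact \<open>B\<close> of \<open>A\<close> coherence of \<open>S\<close> yields a finite
  presentation of \<open>B'\<close>. The first components of its non-zero generators generate \<open>B\<close>, and its
  non-zero relations, stripped of the indices, present \<open>B\<close>: for any \<open>M\<close>-congruence \<open>\<sigma>\<close> containing the
  stripped relations, the extension \<open>(F/\<sigma>)'\<close> satisfies the relations of \<open>B'\<close>.
\<close>

section \<open>Presentations\<close>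

text \<open>The kernel of the act homomorphism from the free act on \<open>X\<close> that sends
  \<open>(x, s)\<close> to \<open>act (e x) s\<close>.\<close>

definition eval_kernel ::
  "('a, 'b) monoid_scheme \<Rightarrow> ('x \<Rightarrow> 'a \<Rightarrow> 'x) \<Rightarrow> 'y set \<Rightarrow> ('y \<Rightarrow> 'x) \<Rightarrow>
     (('y \<times> 'a) \<times> ('y \<times> 'a)) set" where
  "eval_kernel S act X e =
     {((x, s), (y, t)) | x s y t. x \<in> X \<and> s \<in> carrier S \<and> y \<in> X \<and> t \<in> carrier S \<and>
        act (e x) s = act (e y) t}"

text \<open>Generators are named inside \<open>A\<close> by \<open>e\<close>, so no isomorphism has
  to be carried along, and the index type of \<open>X\<close> is free. That \<open>Z\<close>
  generates the kernel is phrased by minimality among congruences, to be used by supplying a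
  suitable \<sigma>.\<close>

definition presentation ::
  "('a, 'b) monoid_scheme \<Rightarrow> 'x set \<Rightarrow> ('x \<Rightarrow> 'a \<Rightarrow> 'x) \<Rightarrow> 'y set \<Rightarrow> ('y \<Rightarrow> 'x) \<Rightarrow>
     (('y \<times> 'a) \<times> ('y \<times> 'a)) set \<Rightarrow> bool" where
  "presentation S A act X e Z \<longleftrightarrow>
     finite X \<and> e ` X \<subseteq> A \<and> A \<subseteq> (\<Union>x\<in>X. act (e x) ` carrier S) \<and>
     finite Z \<and> Z \<subseteq> eval_kernel S act X e \<and>
     (\<forall>\<sigma>. act_congruence S (free_act_carrier S X) (free_act S) \<sigma> \<and> Z \<subseteq> \<sigma> \<longrightarrow>
        eval_kernel S act X e \<subseteq> \<sigma>)"

lemma eval_kernel_iff [simp]: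
  "((x, s), (y, t)) \<in> eval_kernel S act X e \<longleftrightarrow>
     x \<in> X \<and> s \<in> carrier S \<and> y \<in> X \<and> t \<in> carrier S \<and> act (e x) s = act (e y) t"
  by (simp add: eval_kernel_def)

lemma eval_kernel_subset:
  "eval_kernel S act X e \<subseteq> free_act_carrier S X \<times> free_act_carrier S X"
  by (auto simp: eval_kernel_def free_act_carrier_def)

lemma act_congruence_eval_kernel:
  assumes "right_act S A act" "e ` X \<subseteq> A"
  shows "act_congruence S (free_act_carrier S X) (free_act S) (eval_kernel S act X e)"
proof -
  interpret right_act S A act by fact
  have "equiv (free_act_carrier S X) (eval_kernel S act X e)"
  proof (rule equivI)
    show "refl_on (free_act_carrier S X) (eval_kernel S act X e)"
      by (auto simp: refl_on_def free_act_carrier_def)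
    show "sym (eval_kernel S act X e)"
      by (auto simp: sym_def)
    show "trans (eval_kernel S act X e)"
      by (auto simp: trans_def)
  qed (rule eval_kernel_subset)
  moreover have "(free_act S p u, free_act S q u) \<in> eval_kernel S act X e"
    if "(p, q) \<in> eval_kernel S act X e" "u \<in> carrier S" for p q u
  proof -
    obtain x s y t where "p = (x, s)" "q = (y, t)" by (cases p; cases q)
    then show ?thesis using that assms(2) by (simp add: free_act_def act_mult image_subset_iff)
  qed
  ultimately show ?thesis by (auto simp: act_congruence_def)
qed

section \<open>Quotients of acts and free acts\<close>

lemma act_congruence_class_eq_iff:
  assumes "act_congruence S A act \<rho>" "x \<in> A" "y \<in> A"
  shows "\<rho> `` {x} = \<rho> `` {y} \<longleftrightarrow> (x, y) \<in> \<rho>"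
  using assms by (intro eq_equiv_class_iff) (simp_all add: act_congruence_def)

lemma quotient_act_class:
  assumes r: "act_congruence S A act \<rho>" and x: "x \<in> A" and s: "s \<in> carrier S"
  shows "quotient_act act \<rho> (\<rho> `` {x}) s = \<rho> `` {act x s}"
proof -
  have eq: "equiv A \<rho>" using r by (simp add: act_congruence_def)
  have "\<rho> `` {act y s} = \<rho> `` {act x s}" if "(x, y) \<in> \<rho>" for y
  proof -
    have "(act x s, act y s) \<in> \<rho>" using r s that by (auto simp: act_congruence_def)
    then show ?thesis using equiv_class_eq[OF eq] by metis
  qed
  moreover have "(x, x) \<in> \<rho>" using eq x by (meson equiv_def refl_onD)
  ultimately show ?thesis unfolding quotient_act_def by blast
qed

lemma right_act_quotient:
  assumes A: "right_act S A act" and r: "act_congruence S A act \<rho>"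
  shows "right_act S (A // \<rho>) (quotient_act act \<rho>)"
proof -
  interpret right_act S A act by fact
  show ?thesis
    by unfold_locales
      (auto elim!: quotientE intro!: quotientI
        simp: quotient_act_class[OF r] act_closed act_one act_mult)
qed

lemma right_act_free:
  assumes "monoid S"
  shows "right_act S (free_act_carrier S X) (free_act S)"
proof -
  interpret monoid S by fact
  show ?thesis
    by unfold_locales (auto simp: free_act_carrier_def free_act_def m_assoc)
qed

text \<open>First isomorphism theorem: evaluation maps the free act onto \<open>A\<close>, and its
  kernel is generated by the finite set \<open>Z\<close>.\<close>

lemma finitely_presented_if_presentation:
  assumes A: "right_act S A act" and P: "presentation S A act X e Z"
  shows "finitely_presented S A act"
proof -
  interpret right_act S A act by fact
  let ?F = "free_act_carrier S X" and ?K = "eval_kernel S act X e"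
  have eX: "\<And>x. x \<in> X \<Longrightarrow> e x \<in> A"
    and gen: "A \<subseteq> (\<Union>x\<in>X. act (e x) ` carrier S)"
    using P by (auto simp: presentation_def)
  have cg: "act_congruence S ?F (free_act S) ?K"
    using act_congruence_eval_kernel[OF A] P by (auto simp: presentation_def)
  have fg: "finitely_generated_congruence S ?F (free_act S) ?K"
    using P cg unfolding finitely_generated_congruence_def presentation_def by blast
  \<comment> \<open>The fibre of evaluation over \<open>a\<close>. It is a full kernel class, so
    \<open>f\<close> inverts the map that evaluation induces on the quotient.\<close>
  define f where "f a = {(x, s). x \<in> X \<and> s \<in> carrier S \<and> act (e x) s = a}" for a
  have f: "f (act (e x) s) = ?K `` {(x, s)}" if "x \<in> X" "s \<in> carrier S" for x s
    using that by (auto simp: f_def)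
  have "inj_on f A"
  proof (rule inj_onI)
    fix a b assume "a \<in> A" "b \<in> A" and eq: "f a = f b"
    then obtain x s where "x \<in> X" "s \<in> carrier S" "a = act (e x) s" using gen by blast
    then have "(x, s) \<in> f a" by (simp add: f_def)
    then show "a = b" using eq by (auto simp: f_def)
  qed
  moreover have "f ` A = ?F // ?K"
  proof
    show "f ` A \<subseteq> ?F // ?K"
    proof
      fix c assume "c \<in> f ` A"
      then obtain x s where "x \<in> X" "s \<in> carrier S" "c = f (act (e x) s)" using gen by blast
      then show "c \<in> ?F // ?K"
        by (auto simp: f free_act_carrier_def intro: quotientI)
    qed
    show "?F // ?K \<subseteq> f ` A"
      by (auto elim!: quotientE simp: free_act_carrier_def f[symmetric] act_closed eX)
  qed
  moreover have "f (act a t) = quotient_act (free_act S) ?K (f a) t"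
    if a: "a \<in> A" and t: "t \<in> carrier S" for a t
  proof -
    obtain x s where xs: "x \<in> X" "s \<in> carrier S" "a = act (e x) s" using gen a by blast
    then have "f (act a t) = f (act (e x) (s \<otimes>\<^bsub>S\<^esub> t))"
      using t by (simp add: act_mult eX)
    also have "\<dots> = ?K `` {free_act S (x, s) t}"
      using xs t by (simp only: f m_closed free_act_def fst_conv snd_conv)
    also have "\<dots> = quotient_act (free_act S) ?K (f a) t"
      using xs t quotient_act_class[OF cg, of "(x, s)" t]
      by (simp add: f free_act_carrier_def)
    finally show ?thesis .
  qed
  ultimately have "act_iso S A act (?F // ?K) (quotient_act (free_act S) ?K) f"
    by (auto simp: act_iso_def bij_betw_def)
  then show ?thesis
    using finitely_presentedI[OF A _ fg] P by (auto simp: presentation_def)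
qed

text \<open>The generators are the classes of the pairs \<open>(x, \<one>)\<close>, moved into
  \<open>A\<close> by the inverse isomorphism \<open>g\<close>. The kernel of evaluation is then
  \<rho> itself, so a finite set generating \<rho> serves as \<open>Z\<close>.\<close>

lemma presentation_if_finitely_presented:
  assumes "finitely_presented S A act"
  obtains X :: "nat set" and e Z where "presentation S A act X e Z"
proof -
  obtain X :: "nat set" and \<rho> f where A: "right_act S A act" and X: "finite X"
    and r: "finitely_generated_congruence S (free_act_carrier S X) (free_act S) \<rho>"
    and f: "act_iso S A act (free_act_carrier S X // \<rho>) (quotient_act (free_act S) \<rho>) f"
    using assms unfolding finitely_presented_def by blast
  interpret right_act S A act by fact
  let ?F = "free_act_carrier S X"
  obtain Z where cg: "act_congruence S ?F (free_act S) \<rho>" and Z: "finite Z" "Z \<subseteq> \<rho>"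
    and least: "\<And>\<sigma>. act_congruence S ?F (free_act S) \<sigma> \<Longrightarrow> Z \<subseteq> \<sigma> \<Longrightarrow> \<rho> \<subseteq> \<sigma>"
    using r by (auto simp: finitely_generated_congruence_def)
  define g where "g = inv_into A f"
  have g: "act_iso S (?F // \<rho>) (quotient_act (free_act S) \<rho>) A act g"
    unfolding g_def by (rule act_iso_inv[OF f act_closed])
  define e where "e x = g (\<rho> `` {(x, \<one>\<^bsub>S\<^esub>)})" for x
  have ev: "act (e x) s = g (\<rho> `` {(x, s)})" if "x \<in> X" "s \<in> carrier S" for x s
  proof -
    have F: "(x, \<one>\<^bsub>S\<^esub>) \<in> ?F" using that by (simp add: free_act_carrier_def)
    then have "act (e x) s = g (quotient_act (free_act S) \<rho> (\<rho> `` {(x, \<one>\<^bsub>S\<^esub>)}) s)"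
      using g that by (auto simp: act_iso_def e_def quotientI)
    then show ?thesis
      using that by (simp add: quotient_act_class[OF cg F] free_act_def)
  qed
  have bij: "bij_betw g (?F // \<rho>) A" using g by (simp add: act_iso_def)
  have \<rho>_sub: "\<rho> \<subseteq> ?F \<times> ?F" using cg by (auto simp: act_congruence_def equiv_def)
  have ker: "eval_kernel S act X e = \<rho>"
  proof -
    have "(p, q) \<in> eval_kernel S act X e \<longleftrightarrow> (p, q) \<in> \<rho>" if "p \<in> ?F" "q \<in> ?F" for p q
    proof -
      obtain x s y t where pq: "p = (x, s)" "q = (y, t)" by (cases p; cases q)
      have "(p, q) \<in> eval_kernel S act X e \<longleftrightarrow> g (\<rho> `` {p}) = g (\<rho> `` {q})"
        using that by (auto simp: pq ev free_act_carrier_def)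
      also have "\<dots> \<longleftrightarrow> \<rho> `` {p} = \<rho> `` {q}"
        using bij that by (auto simp: bij_betw_def inj_on_eq_iff quotientI)
      also have "\<dots> \<longleftrightarrow> (p, q) \<in> \<rho>"
        by (rule act_congruence_class_eq_iff[OF cg that])
      finally show ?thesis .
    qed
    then show ?thesis using eval_kernel_subset[of S act X e] \<rho>_sub by blast
  qed
  have "e ` X \<subseteq> A"
    using bij by (auto simp: e_def bij_betw_def free_act_carrier_def intro!: imageI quotientI)
  moreover have "A \<subseteq> (\<Union>x\<in>X. act (e x) ` carrier S)"
  proof
    fix a assume "a \<in> A"
    then obtain c where c: "c \<in> ?F // \<rho>" "a = g c" using bij by (auto simp: bij_betw_def)
    then obtain x s where "x \<in> X" "s \<in> carrier S" "c = \<rho> `` {(x, s)}"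
      by (auto elim!: quotientE simp: free_act_carrier_def)
    then show "a \<in> (\<Union>x\<in>X. act (e x) ` carrier S)" using c ev by auto
  qed
  ultimately have "presentation S A act X e Z"
    using X Z least by (simp add: presentation_def ker)
  then show thesis by (rule that)
qed

section \<open>The Brandt extension of an act\<close>

text \<open>In the extension, \<^term>\<open>None\<close> is the zero; as an element of the Brandt monoid it is the identity.\<close>

fun brandt_act ::
  "('x \<Rightarrow> 'a \<Rightarrow> 'x) \<Rightarrow> ('x \<times> 'i) option \<Rightarrow> ('i, 'a) brandt option \<Rightarrow> ('x \<times> 'i) option" where
  "brandt_act act u None = u"
| "brandt_act act None (Some s) = None"
| "brandt_act act (Some p) (Some Zero) = None"
| "brandt_act act (Some (x, j)) (Some (Triple k a l)) =
     (if j = k then Some (act x a, l) else None)"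

definition brandt_ext :: "'x set \<Rightarrow> 'i set \<Rightarrow> ('x \<times> 'i) option set" where
  "brandt_ext A I = insert None (Some ` (A \<times> I))"

lemma brandt_ext_simps [simp]:
  "None \<in> brandt_ext A I" "Some (x, j) \<in> brandt_ext A I \<longleftrightarrow> x \<in> A \<and> j \<in> I"
  by (auto simp: brandt_ext_def)

lemma brandt_monoid_simps [simp]:
  "None \<in> carrier (brandt_monoid M I)"
  "Some Zero \<in> carrier (brandt_monoid M I)"
  "Some (Triple j a k) \<in> carrier (brandt_monoid M I) \<longleftrightarrow> j \<in> I \<and> a \<in> carrier M \<and> k \<in> I"
  "\<one>\<^bsub>brandt_monoid M I\<^esub> = None"
  "mult (brandt_monoid M I) = adjoin_one_mult (brandt_mult M)"
  by (auto simp: brandt_monoid_def adjoin_one_def brandt_carrier_def)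

lemma brandt_act_None [simp]: "brandt_act act None s = None"
  by (cases s) auto

lemma brandt_act_Zero [simp]: "brandt_act act u (Some Zero) = None"
  by (cases u) auto

lemma brandt_option_cases:
  obtains "s = None" | "s = Some Zero" | j a k where "s = Some (Triple j a k)"
  by (cases s) (auto intro: brandt.exhaust)

text \<open>A non-zero result determines the shape of the acting element; this lets indices be
  traced back from results.\<close>

lemma brandt_act_Some_eq_iff:
  "brandt_act act (Some (x, j)) s = Some (y, l) \<longleftrightarrow>
     s = None \<and> y = x \<and> l = j \<or> (\<exists>a. s = Some (Triple j a l) \<and> y = act x a)"
  by (cases s rule: brandt_option_cases) auto

section \<open>Act structure, subacts and finite generation of the extension\<close>

lemma right_act_brandt:
  assumes "right_act M A act"
  shows "right_act (brandt_monoid M I) (brandt_ext A I) (brandt_act act)"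
proof -
  interpret A: right_act M A act by fact
  interpret S: monoid "brandt_monoid M I" by (rule monoid_brandt_monoid) unfold_locales
  show ?thesis
  proof
    fix u s assume "u \<in> brandt_ext A I" "s \<in> carrier (brandt_monoid M I)"
    then show "brandt_act act u s \<in> brandt_ext A I"
      by (cases u; cases s rule: brandt_option_cases) (auto simp: A.act_closed)
  next
    fix u s t assume "u \<in> brandt_ext A I" "s \<in> carrier (brandt_monoid M I)"
      "t \<in> carrier (brandt_monoid M I)"
    then show "brandt_act act u (s \<otimes>\<^bsub>brandt_monoid M I\<^esub> t) = brandt_act act (brandt_act act u s) t"
      by (cases u; cases s rule: brandt_option_cases; cases t rule: brandt_option_cases)
        (auto simp: A.act_mult)
  qed simp
qed

text \<open>Closure comes for free: the extension of \<open>B\<close> is an act in its own right,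
  under the same action.\<close>

lemma subact_brandt:
  assumes "right_act M A act" "subact M B A act"
  shows "subact (brandt_monoid M I) (brandt_ext B I) (brandt_ext A I) (brandt_act act)"
proof -
  interpret right_act "brandt_monoid M I" "brandt_ext B I" "brandt_act act"
    by (rule right_act_brandt[OF right_act_subact[OF assms]])
  show ?thesis
    using assms(2) act_closed by (auto simp: subact_def brandt_ext_def)
qed

text \<open>Generators at the single index \<open>i\<close> suffice, because
  \<open>Triple i m j\<close> moves them to any index \<open>j\<close>. The zero is listed
  separately since \<open>G\<close> may be empty.\<close>

lemma finitely_generated_brandt:
  assumes "right_act M B act" "i \<in> I" "finitely_generated_act M B act"
  shows "finitely_generated_act (brandt_monoid M I) (brandt_ext B I) (brandt_act act)"
proof -
  interpret right_act "brandt_monoid M I" "brandt_ext B I" "brandt_act act"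
    by (rule right_act_brandt[OF assms(1)])
  obtain G where G: "finite G" "G \<subseteq> B" "B = (\<Union>a\<in>G. act a ` carrier M)"
    using assms(3) by (auto simp: finitely_generated_act_def)
  let ?G = "insert None ((\<lambda>a. Some (a, i)) ` G)"
  have GB: "?G \<subseteq> brandt_ext B I" using G(2) assms(2) by auto
  have "u \<in> (\<Union>a\<in>?G. brandt_act act a ` carrier (brandt_monoid M I))"
    if u: "u \<in> brandt_ext B I" for u
  proof (cases u)
    case (Some p)
    then obtain b j where b: "u = Some (b, j)" "b \<in> B" "j \<in> I" using u by (cases p) auto
    then obtain a m where "a \<in> G" "m \<in> carrier M" "b = act a m" using G(3) by blast
    then show ?thesis
      using b assms(2)
      by (intro UN_I[of "Some (a, i)"] image_eqI[of _ _ "Some (Triple i m j)"]) auto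
  qed auto
  then have "brandt_ext B I = (\<Union>a\<in>?G. brandt_act act a ` carrier (brandt_monoid M I))"
    using GB act_closed by blast
  then show ?thesis
    unfolding finitely_generated_act_def using G(1) GB by (intro exI[of _ ?G]) simp
qed

section \<open>Finite presentations pass to the extension\<close>

lemma finitely_presented_brandt:
  fixes M :: "('a, 'b) monoid_scheme" and A :: "'x set" and I :: "'i set"
  assumes A: "finitely_presented M A act" and i: "i \<in> I"
  shows "finitely_presented (brandt_monoid M I) (brandt_ext A I) (brandt_act act)"
proof -
  obtain X :: "nat set" and e Z where P: "presentation M A act X e Z"
    using A by (rule presentation_if_finitely_presented)
  have ra: "right_act M A act" using A by (simp add: finitely_presented_def)
  interpret right_act M A act by (rule ra)
  let ?S = "brandt_monoid M I"
  interpret S: monoid ?S by (rule monoid_brandt_monoid) unfold_locales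
  have eX: "\<And>x. x \<in> X \<Longrightarrow> e x \<in> A"
    and gen: "A \<subseteq> (\<Union>x\<in>X. act (e x) ` carrier M)"
    and Z: "Z \<subseteq> eval_kernel M act X e" and fin: "finite X" "finite Z"
    and least: "\<And>\<sigma>. act_congruence M (free_act_carrier M X) (free_act M) \<sigma> \<Longrightarrow> Z \<subseteq> \<sigma> \<Longrightarrow>
      eval_kernel M act X e \<subseteq> \<sigma>"
    using P by (auto simp: presentation_def)
  \<comment> \<open>The extra generator \<^term>\<open>None\<close> for the zero is needed when \<open>A\<close> is empty.\<close>
  let ?Y = "insert None (Some ` X)"
  define d where "d = map_option (\<lambda>x. (e x, i))"
  \<comment> \<open>The elements \<open>Triple i m i\<close> form a copy of \<open>M\<close>;
    \<iota> uses it to lift the free \<open>M\<close>-act into the free act over the Brandt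
    monoid.\<close>
  define \<iota> :: "nat \<times> 'a \<Rightarrow> nat option \<times> ('i, 'a) brandt option"
    where "\<iota> = (\<lambda>(x, m). (Some x, Some (Triple i m i)))"
  define z :: "nat option \<times> ('i, 'a) brandt option" where "z = (None, Some Zero)"
  \<comment> \<open>The first relation and those for \<open>Some Zero\<close> identify all zeros
    with \<open>z\<close>; the second family places each generator at index \<open>i\<close>; the
    last transports \<open>Z\<close>.\<close>
  define R where "R = insert ((None, None), z)
    ((\<lambda>x. ((Some x, None), \<iota> (x, \<one>\<^bsub>M\<^esub>))) ` X \<union>
     (\<lambda>x. ((Some x, Some Zero), z)) ` X \<union> map_prod \<iota> \<iota> ` Z)"
  let ?F = "free_act_carrier ?S ?Y"
  have "eval_kernel ?S (brandt_act act) ?Y d \<subseteq> \<sigma>"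
    if \<sigma>: "act_congruence ?S ?F (free_act ?S) \<sigma>" and R: "R \<subseteq> \<sigma>" for \<sigma>
  proof -
    have refl: "\<And>p. p \<in> ?F \<Longrightarrow> (p, p) \<in> \<sigma>"
      and sym: "\<And>p q. (p, q) \<in> \<sigma> \<Longrightarrow> (q, p) \<in> \<sigma>"
      and trans: "\<And>p q r. (p, q) \<in> \<sigma> \<Longrightarrow> (q, r) \<in> \<sigma> \<Longrightarrow> (p, r) \<in> \<sigma>"
      and cg: "\<And>p q s. (p, q) \<in> \<sigma> \<Longrightarrow> s \<in> carrier ?S \<Longrightarrow>
        (free_act ?S p s, free_act ?S q s) \<in> \<sigma>"
      using \<sigma> unfolding act_congruence_def equiv_def
      by (auto dest: refl_onD symD transD)
    have R1: "((None, None), z) \<in> \<sigma>"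
      and R2: "\<And>x. x \<in> X \<Longrightarrow> ((Some x, None), \<iota> (x, \<one>\<^bsub>M\<^esub>)) \<in> \<sigma>"
      and R3: "\<And>x. x \<in> X \<Longrightarrow> ((Some x, Some Zero), z) \<in> \<sigma>"
      and R4: "map_prod \<iota> \<iota> ` Z \<subseteq> \<sigma>"
      using R by (auto simp: R_def)
    have \<iota>_F: "\<iota> p \<in> ?F" if "p \<in> free_act_carrier M X" for p
      using that i by (auto simp: \<iota>_def free_act_carrier_def)
    \<comment> \<open>The pullback of \<sigma> along \<iota>. It is an \<open>M\<close>-congruence
      because acting by \<open>Triple i m i\<close> on the image of \<iota> is acting by
      \<open>m\<close>, so minimality of the kernel over \<open>M\<close> applies to it.\<close>
    define \<tau> where "\<tau> = {(p, q). p \<in> free_act_carrier M X \<and> q \<in> free_act_carrier M X \<and>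
      (\<iota> p, \<iota> q) \<in> \<sigma>}"
    have \<tau>_act: "(free_act M p m, free_act M q m) \<in> \<tau>"
      if "(p, q) \<in> \<tau>" and m: "m \<in> carrier M" for p q m
      using that i cg[of "\<iota> p" "\<iota> q" "Some (Triple i m i)"]
      by (auto simp: \<tau>_def \<iota>_def free_act_def free_act_carrier_def)
    have "equiv (free_act_carrier M X) \<tau>"
      by (rule equivI) (auto simp: \<tau>_def refl_on_def sym_def trans_def \<iota>_F
          intro: refl sym trans)
    then have "act_congruence M (free_act_carrier M X) (free_act M) \<tau>"
      using \<tau>_act by (auto simp: act_congruence_def)
    moreover have "Z \<subseteq> \<tau>"
      using R4 Z eval_kernel_subset[of M act X e] by (auto simp: \<tau>_def)
    ultimately have ker: "eval_kernel M act X e \<subseteq> \<tau>" by (rule least)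
    have zero: "((x, Some Zero), z) \<in> \<sigma>" if "x \<in> ?Y" for x
      using that R3 refl[of z] by (auto simp: z_def free_act_carrier_def)
    \<comment> \<open>Modulo \<open>\<sigma>\<close> every element is the zero or of the form \<open>y(i, m, l)\<close>.\<close>
    have nf: "case brandt_act act (d x) s of None \<Rightarrow> ((x, s), z) \<in> \<sigma>
      | Some (a, l) \<Rightarrow> \<exists>y m. x = Some y \<and> m \<in> carrier M \<and> l \<in> I \<and> act (e y) m = a \<and>
          ((x, s), (x, Some (Triple i m l))) \<in> \<sigma>"
      if x: "x \<in> ?Y" and s: "s \<in> carrier ?S" for x s
    proof (cases x)
      case None
      \<comment> \<open>\<open>z\<close> is fixed by the action, so the relation for the extra
        generator extends to all its multiples.\<close>
      have "free_act ?S z s = z"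
        by (cases s rule: brandt_option_cases) (auto simp: z_def free_act_def)
      then show ?thesis using cg[OF R1 s] None by (simp add: free_act_def d_def)
    next
      case (Some y)
      then have y: "y \<in> X" using x by auto
      \<comment> \<open>Replacing \<open>y\<close> by its product with
        \<open>Triple i \<one> i\<close> before acting: \<open>s = None\<close> becomes that triple,
        a triple starting at \<open>i\<close> survives, and one starting elsewhere gives
        zero.\<close>
      have e: "((Some y, s), free_act ?S (\<iota> (y, \<one>\<^bsub>M\<^esub>)) s) \<in> \<sigma>"
        using cg[OF R2[OF y] s] by (simp add: free_act_def)
      show ?thesis
      proof (cases s rule: brandt_option_cases)
        case 1
        then show ?thesis using y i e Some
          by (auto simp: d_def \<iota>_def free_act_def act_one eX)
      next
        case 2
        then show ?thesis using zero x by simp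
      next
        case (3 j m k)
        then show ?thesis
          using s e Some trans[OF _ zero[OF x]] by (auto simp: d_def \<iota>_def free_act_def)
      qed
    qed
    show ?thesis
    proof (rule subrelI)
      fix p q assume pq: "(p, q) \<in> eval_kernel ?S (brandt_act act) ?Y d"
      then obtain x s y t where eqs: "p = (x, s)" "q = (y, t)" by (cases p; cases q)
      with pq have x: "x \<in> ?Y" "s \<in> carrier ?S" and y: "y \<in> ?Y" "t \<in> carrier ?S"
        and eq: "brandt_act act (d x) s = brandt_act act (d y) t" by simp_all
      show "(p, q) \<in> \<sigma>"
      proof (cases "brandt_act act (d x) s")
        case None
        then have "(p, z) \<in> \<sigma>" "(q, z) \<in> \<sigma>" using nf[OF x] nf[OF y] eq eqs by simp_all
        then show ?thesis using sym trans by blast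
      next
        case (Some al)
        then obtain a l where al: "brandt_act act (d x) s = Some (a, l)" by (cases al) simp
        obtain x' m where m: "x = Some x'" "m \<in> carrier M" "l \<in> I" "act (e x') m = a"
          "(p, (x, Some (Triple i m l))) \<in> \<sigma>"
          using nf[OF x] al eqs by auto
        obtain y' n where n: "y = Some y'" "n \<in> carrier M" "act (e y') n = a"
          "(q, (y, Some (Triple i n l))) \<in> \<sigma>"
          using nf[OF y] al eq eqs by auto
        have "((x', m), (y', n)) \<in> \<tau>" using ker m n x(1) y(1) by auto
        then have "(\<iota> (x', m), \<iota> (y', n)) \<in> \<sigma>" by (simp add: \<tau>_def)
        \<comment> \<open>The lifted relation ends at index \<open>i\<close> on both sides; acting
          by \<open>Triple i \<one> l\<close> moves both ends to \<open>l\<close>.\<close>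
        from cg[OF this, of "Some (Triple i \<one>\<^bsub>M\<^esub> l)"]
        have "((x, Some (Triple i m l)), (y, Some (Triple i n l))) \<in> \<sigma>"
          using m n i by (simp add: \<iota>_def free_act_def)
        then show ?thesis using m(5) n(4) sym trans by blast
      qed
    qed
  qed
  moreover have "R \<subseteq> eval_kernel ?S (brandt_act act) ?Y d"
  proof -
    have "(\<iota> p, \<iota> q) \<in> eval_kernel ?S (brandt_act act) ?Y d" if "(p, q) \<in> Z" for p q
      using that Z i by (cases p; cases q) (auto simp: \<iota>_def d_def)
    then show ?thesis
      using i eX by (auto simp: R_def z_def \<iota>_def d_def act_one)
  qed
  moreover have "brandt_ext A I \<subseteq> (\<Union>x\<in>?Y. brandt_act act (d x) ` carrier ?S)"
  proof
    fix u assume u: "u \<in> brandt_ext A I"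
    show "u \<in> (\<Union>x\<in>?Y. brandt_act act (d x) ` carrier ?S)"
    proof (cases u)
      case None
      then show ?thesis
        by (intro UN_I[of None] image_eqI[of _ _ None]) (auto simp: d_def)
    next
      case (Some p)
      then obtain b j where b: "u = Some (b, j)" "b \<in> A" "j \<in> I" using u by (cases p) auto
      then obtain x m where "x \<in> X" "m \<in> carrier M" "b = act (e x) m" using gen by blast
      then show ?thesis
        using b i by (intro UN_I[of "Some x"] image_eqI[of _ _ "Some (Triple i m j)"])
          (auto simp: d_def)
    qed
  qed
  moreover have "d ` ?Y \<subseteq> brandt_ext A I" using i eX by (auto simp: d_def)
  moreover have "finite R" using fin by (simp add: R_def)
  ultimately have "presentation ?S (brandt_ext A I) (brandt_act act) ?Y d R"
    using fin by (simp add: presentation_def)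
  then show ?thesis
    by (rule finitely_presented_if_presentation[OF right_act_brandt[OF ra]])
qed

section \<open>Finite presentations descend from the extension\<close>

lemma finitely_presented_if_brandt:
  fixes M :: "('a, 'b) monoid_scheme" and B :: "'x set" and I :: "'i set"
  assumes ra: "right_act M B act" and i: "i \<in> I"
    and fp: "finitely_presented (brandt_monoid M I) (brandt_ext B I) (brandt_act act)"
  shows "finitely_presented M B act"
proof -
  let ?S = "brandt_monoid M I"
  interpret right_act M B act by (rule ra)
  obtain Y :: "nat set" and d R where
    P: "presentation ?S (brandt_ext B I) (brandt_act act) Y d R"
    using fp by (rule presentation_if_finitely_presented)
  have dY: "\<And>y. y \<in> Y \<Longrightarrow> d y \<in> brandt_ext B I"
    and gen: "brandt_ext B I \<subseteq> (\<Union>y\<in>Y. brandt_act act (d y) ` carrier ?S)"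
    and R: "R \<subseteq> eval_kernel ?S (brandt_act act) Y d" and fin: "finite Y" "finite R"
    and least: "\<And>\<sigma>. act_congruence ?S (free_act_carrier ?S Y) (free_act ?S) \<sigma> \<Longrightarrow> R \<subseteq> \<sigma> \<Longrightarrow>
      eval_kernel ?S (brandt_act act) Y d \<subseteq> \<sigma>"
    using P by (auto simp: presentation_def)
  define X where "X = {y \<in> Y. d y \<noteq> None}"
  \<comment> \<open>The two coordinates of a generator, meaningful only on \<open>X\<close>, where
    \<open>d y\<close> is not the zero.\<close>
  define e where "e y = fst (the (d y))" for y
  define c where "c y = snd (the (d y))" for y
  have d: "d y = Some (e y, c y)" "e y \<in> B" "c y \<in> I" if "y \<in> X" for y
    using that dY[of y] by (auto simp: X_def e_def c_def)
  have d_None: "d y = None" if "y \<in> Y" "y \<notin> X" for y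
    using that unfolding X_def by blast
  have XY: "X \<subseteq> Y" by (auto simp: X_def)
  \<comment> \<open>The \<open>M\<close>-component of an acting element. For the adjoined identity
    \<open>None\<close> it has to be \<one>; for \<open>Some Zero\<close>, which never yields a
    non-zero result, it is a filler in the carrier.\<close>
  define \<mu> :: "('i, 'a) brandt option \<Rightarrow> 'a"
    where "\<mu> s = (case s of Some (Triple j m l) \<Rightarrow> m | _ \<Rightarrow> \<one>\<^bsub>M\<^esub>)" for s
  have \<mu>: "\<mu> s \<in> carrier M" if "s \<in> carrier ?S" for s
    using that by (cases s rule: brandt_option_cases) (auto simp: \<mu>_def)
  \<comment> \<open>Whether the product vanishes, and its final index, depend only on
    \<open>c y\<close> and \<open>s\<close>.\<close>
  have dact: "brandt_act act (Some (b, c y)) s = Some (act b (\<mu> s), l)"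
    if "brandt_act act (d y) s = Some (a, l)" "y \<in> X" "b \<in> B" for y s a l b
    using that d[of y] by (auto simp: brandt_act_Some_eq_iff \<mu>_def act_one)
  \<comment> \<open>The non-zero relations; the final indices on both sides agree, so they can be dropped.\<close>
  define Z where "Z = map_prod (map_prod id \<mu>) (map_prod id \<mu>) `
    {((x, s), (y, t)) | x s y t. ((x, s), (y, t)) \<in> R \<and> brandt_act act (d x) s \<noteq> None}"
  have nonzero: "x \<in> X" if "brandt_act act (d x) s \<noteq> None" "x \<in> Y" for x s
    using that by (cases "d x") (auto simp: X_def)
  have ZK: "Z \<subseteq> eval_kernel M act X e"
  proof -
    have "((x, \<mu> s), (y, \<mu> t)) \<in> eval_kernel M act X e"
      if "((x, s), (y, t)) \<in> R" and nz: "brandt_act act (d x) s \<noteq> None" for x s y t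
    proof -
      have m: "x \<in> Y" "s \<in> carrier ?S" "y \<in> Y" "t \<in> carrier ?S"
        and eq: "brandt_act act (d x) s = brandt_act act (d y) t" using that R by auto
      obtain a l where al: "brandt_act act (d x) s = Some (a, l)" using nz by auto
      have xy: "x \<in> X" "y \<in> X" using nonzero nz eq m by metis+
      have "Some (act (e x) (\<mu> s), l) = Some (act (e y) (\<mu> t), l)"
        using dact[OF al xy(1) d(2)[OF xy(1)]] dact[of y t a l, OF _ xy(2) d(2)[OF xy(2)]]
          eq al d(1) xy by simp
      then show ?thesis using xy m \<mu> by simp
    qed
    then show ?thesis by (auto simp: Z_def)
  qed
  have "eval_kernel M act X e \<subseteq> \<sigma>"
    if \<sigma>: "act_congruence M (free_act_carrier M X) (free_act M) \<sigma>" and Z: "Z \<subseteq> \<sigma>" for \<sigma>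
  proof -
    let ?F = "free_act_carrier M X" and ?q = "quotient_act (free_act M) \<sigma>"
    interpret Q: right_act M "?F // \<sigma>" ?q
      by (rule right_act_quotient[OF right_act_free \<sigma>]) unfold_locales
    \<comment> \<open>A new assignment of the generators \<open>Y\<close>, now into the extension of
      the quotient by \<sigma>: each keeps its index \<open>c y\<close>, and those outside
      \<open>X\<close> still go to zero.\<close>
    define h where "h y = (if y \<in> X then Some (\<sigma> `` {(y, \<one>\<^bsub>M\<^esub>)}, c y) else None)" for y
    have one_F: "(y, \<one>\<^bsub>M\<^esub>) \<in> ?F" if "y \<in> X" for y
      using that by (simp add: free_act_carrier_def)
    have q: "?q (\<sigma> `` {(y, \<one>\<^bsub>M\<^esub>)}) m = \<sigma> `` {(y, m)}" if "y \<in> X" "m \<in> carrier M" for y m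
      using that by (simp add: quotient_act_class[OF \<sigma> one_F]) (simp add: free_act_def)
    have h_ext: "h ` Y \<subseteq> brandt_ext (?F // \<sigma>) I"
      by (auto simp: h_def d quotientI one_F)
    \<comment> \<open>Values under \<open>h\<close> and \<open>d\<close> vanish together and share
      final indices. So the zero relations in \<open>R\<close> hold for \<open>h\<close>
      automatically, and the others reduce to \<open>Z\<close> being contained in \<sigma>.\<close>
    have h_act: "brandt_act ?q (h y) s = map_option (\<lambda>(_, l). (\<sigma> `` {(y, \<mu> s)}, l))
        (brandt_act act (d y) s)" if "y \<in> Y" "s \<in> carrier ?S" for y s
    proof (cases "y \<in> X")
      case True
      then show ?thesis
        using that q[OF True] Q.act_one[OF quotientI[OF one_F[OF True]]]
        by (cases s rule: brandt_option_cases) (auto simp: h_def d \<mu>_def)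
    qed (simp add: h_def d_None that)
    have "R \<subseteq> eval_kernel ?S (brandt_act ?q) Y h"
    proof (rule subrelI)
      fix p p' assume r: "(p, p') \<in> R"
      obtain x s y t where eqs: "p = (x, s)" "p' = (y, t)" by (cases p; cases p')
      have m: "x \<in> Y" "s \<in> carrier ?S" "y \<in> Y" "t \<in> carrier ?S"
        and eq: "brandt_act act (d x) s = brandt_act act (d y) t" using r R eqs by auto
      have "brandt_act ?q (h x) s = brandt_act ?q (h y) t"
      proof (cases "brandt_act act (d x) s")
        case None
        then show ?thesis using h_act m eq by simp
      next
        case (Some al)
        then have "((x, \<mu> s), (y, \<mu> t)) \<in> Z" using r eqs by (force simp: Z_def)
        then have "((x, \<mu> s), (y, \<mu> t)) \<in> \<sigma>" using Z by blast
        then have "\<sigma> `` {(x, \<mu> s)} = \<sigma> `` {(y, \<mu> t)}"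
          using \<sigma> by (intro equiv_class_eq) (auto simp: act_congruence_def)
        then show ?thesis using h_act m eq by simp
      qed
      then show "(p, p') \<in> eval_kernel ?S (brandt_act ?q) Y h" using m eqs by simp
    qed
    \<comment> \<open>The kernel of evaluation along \<open>h\<close> is a congruence containing
      \<open>R\<close>, hence a legitimate choice in the minimality condition for
      \<open>R\<close>.\<close>
    then have ker: "eval_kernel ?S (brandt_act act) Y d \<subseteq> eval_kernel ?S (brandt_act ?q) Y h"
      by (intro least act_congruence_eval_kernel[OF right_act_brandt[OF Q.right_act_axioms] h_ext])
    show ?thesis
    proof (rule subrelI)
      fix p p' assume r: "(p, p') \<in> eval_kernel M act X e"
      obtain x m y n where eqs: "p = (x, m)" "p' = (y, n)" by (cases p; cases p')
      have m: "x \<in> X" "m \<in> carrier M" "y \<in> X" "n \<in> carrier M"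
        and eq: "act (e x) m = act (e y) n" using r eqs by auto
      \<comment> \<open>Each triple starts at the index of its generator and both end at
        \<open>i\<close>, so an equation in \<open>B\<close> lifts to a non-zero equation in the
        extension. Reading it under \<open>h\<close> yields equal \<sigma>-classes.\<close>
      let ?s = "Some (Triple (c x) m i)" and ?t = "Some (Triple (c y) n i)"
      have "((x, ?s), (y, ?t)) \<in> eval_kernel ?S (brandt_act act) Y d"
        using m eq XY i by (auto simp: d)
      from subsetD[OF ker this] have "brandt_act ?q (h x) ?s = brandt_act ?q (h y) ?t" by simp
      then have "\<sigma> `` {(x, m)} = \<sigma> `` {(y, n)}" using m q by (simp add: h_def)
      then show "(p, p') \<in> \<sigma>"
        using act_congruence_class_eq_iff[OF \<sigma>, of p p'] m eqs
        by (simp add: free_act_carrier_def)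
    qed
  qed
  moreover have "B \<subseteq> (\<Union>x\<in>X. act (e x) ` carrier M)"
  proof
    fix b assume b: "b \<in> B"
    then have "Some (b, i) \<in> brandt_ext B I" using i by simp
    from subsetD[OF gen this] obtain y s where ys: "y \<in> Y" "s \<in> carrier ?S"
      "brandt_act act (d y) s = Some (b, i)"
      by (elim UN_E imageE) simp
    then have y: "y \<in> X" using nonzero by blast
    then have "b = act (e y) (\<mu> s)" using dact[OF ys(3) y d(2)[OF y]] ys(3) d(1)[OF y] by simp
    then show "b \<in> (\<Union>x\<in>X. act (e x) ` carrier M)" using y \<mu>[OF ys(2)] by blast
  qed
  moreover have "finite Z"
    unfolding Z_def by (intro finite_imageI finite_subset[OF _ fin(2)]) auto
  moreover have "finite X" using fin XY finite_subset by blast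
  ultimately have "presentation M B act X e Z"
    using ZK d(2) by (auto simp: presentation_def)
  then show ?thesis by (rule finitely_presented_if_presentation[OF ra])
qed

theorem corollary4p10:
  fixes M :: "('a, 'b) monoid_scheme" and I :: "'i set"
  assumes "monoid M"
    and "I \<noteq> {}"
    and "right_coherent (brandt_monoid M I)"
  shows "right_coherent M"
proof -
  obtain i where i: "i \<in> I" using assms(2) by blast
  have "finitely_presented M B act"
    if A: "finitely_presented M A act" and B: "subact M B A act"
      and G: "finitely_generated_act M B act" for A :: "(nat \<times> 'a) set set" and act B
  proof -
    have ra: "right_act M A act" using A by (simp add: finitely_presented_def)
    have rb: "right_act M B act" by (rule right_act_subact[OF ra B])
    \<comment> \<open>The extended acts have elements of type
      \<open>((nat \<times> 'a) set \<times> 'i) option\<close>, not the type fixed in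
      \<open>right_coherent\<close>; \<open>right_coherentD\<close> bridges this.\<close>
    have "finitely_presented (brandt_monoid M I) (brandt_ext B I) (brandt_act act)"
      by (rule right_coherentD[OF assms(3) finitely_presented_brandt[OF A i]
            subact_brandt[OF ra B] finitely_generated_brandt[OF rb i G]])
    then show ?thesis by (rule finitely_presented_if_brandt[OF rb i])
  qed
  then show ?thesis unfolding right_coherent_def by blast
qed

end
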